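(* Let $C_i\in\mathbb{R}^{p_i\times n}$ for $i=1,\dots,N$, and $C=[C_1^T\ \cdots\ C_N^T]^T$. Let $\begin{bmatrix} Q_j & S_j\\ S_j^T & R_j\end{bmatrix}\in\mathbb{S}^{m+n}$ and $R_j\in\mathbb{S}^m_{+}$ for $j=0,\dots,M$. Then, for $K\in\mathbb{K}$, the set of quadratic inequalities $$\begin{bmatrix} x\\ KCx\end{bmatrix}^T\begin{bmatrix} Q_j & S_j\\ S_j^T & R_j\end{bmatrix}\begin{bmatrix} x\\ KCx\end{bmatrix}\le 0\quad\text{for all }x\in\mathbb{R}^n,\qquad j=0,\dots,M,$$ is equivalent to the set of linear matrix inequalities $$\begin{bmatrix} Q_j+S_jKC+C^TK^TS_j^T & C^TK^TR_j\\ R_jKC & -R_j\end{bmatrix}\preceq 0,\qquad j=0,\dots,M.$$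
   Context: $\mathbb{S}^k$ and $\mathbb{S}^k_{+}$ denote the sets of real symmetric and of symmetric positive semidefinite $k\times k$ matrices; $A\preceq 0$ means $-A$ is symmetric positive semidefinite. In each block matrix, $Q_j\in\mathbb{R}^{n\times n}$, $S_j\in\mathbb{R}^{n\times m}$, $R_j\in\mathbb{R}^{m\times m}$. There are $N$ decision makers; $p=p_1+\dots+p_N$ and $m=m_1+\dots+m_N$ with positive integers $p_i,m_i$, so $C\in\mathbb{R}^{p\times n}$. $\mathbb{K}$ is the set of block-diagonal matrices $K=\mathrm{diag}(K_1,\dots,K_N)$ with $K_i\in\mathbb{R}^{m_i\times p_i}$ (linear decisions $\mu(Cx)=KCx$ in which decision maker $i$ uses only $C_ix$). *)

theory Defs
  imports "Jordan_Normal_Form.Matrix"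
begin

definition sym_mats :: "nat \<Rightarrow> real mat set" where
  "sym_mats k = {A \<in> carrier_mat k k. A\<^sup>T = A}"

definition psd_mats :: "nat \<Rightarrow> real mat set" where
  "psd_mats k = {A \<in> sym_mats k. \<forall>v \<in> carrier_vec k. 0 \<le> v \<bullet> (A *\<^sub>v v)}"

(* Negative semidefiniteness; the size k is made explicit because the type of matrices
   does not record it. *)
definition nsd :: "nat \<Rightarrow> real mat \<Rightarrow> bool" where
  "nsd k A \<longleftrightarrow> - A \<in> psd_mats k"

(* The blocks C 1, ..., C N, each with n columns, stacked on top of each other.
   The zero-row matrix is the neutral element of stacking. *)
definition stack_rows :: "nat \<Rightarrow> nat \<Rightarrow> (nat \<Rightarrow> real mat) \<Rightarrow> real mat" where
  "stack_rows n N C = foldr append_rows (map C [1..<Suc N]) (0\<^sub>m 0 n)"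

(* The decentralized gains diag (K 1, ..., K N), K i having m i rows and p i columns. *)
definition block_diag_gains :: "nat \<Rightarrow> (nat \<Rightarrow> nat) \<Rightarrow> (nat \<Rightarrow> nat) \<Rightarrow> real mat set" where
  "block_diag_gains N m p =
     {diag_block_mat (map K [1..<Suc N]) | K. \<forall>i\<in>{1..N}. K i \<in> carrier_mat (m i) (p i)}"

end

theory Submission
  imports Defs
begin

text \<open>With \<open>L = K C\<close>, completing the square turns the quadratic form of the matrix in the
  LMI at \<open>(x, y)\<close> into the quadratic form of the original block matrix at \<open>(x, L x)\<close> minus
  \<open>(y - L x)\<^sup>T R (y - L x)\<close>. Since \<open>R\<close> is positive semidefinite, the supremum over \<open>y\<close>
  is attained at \<open>y = L x\<close>.\<close>

lemma carrier_stack_rows: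
  assumes "\<And>i. i \<in> {1..N} \<Longrightarrow> C i \<in> carrier_mat (p i) n"
  shows "stack_rows n N C \<in> carrier_mat (\<Sum>i=1..N. p i) n"
proof -
  \<comment> \<open>Generalised from \<open>[1..<Suc N]\<close> to any list of indices in
    \<open>{1..N}\<close>, so that the induction hypothesis applies to the tail.\<close>
  have "foldr append_rows (map C is) (0\<^sub>m 0 n) \<in> carrier_mat (sum_list (map p is)) n"
    if "set is \<subseteq> {1..N}" for "is"
    using that assms by (induction "is") auto
  from this[of "[1..<Suc N]"] show ?thesis
    by (simp add: stack_rows_def sum_set_upt_conv_sum_list_nat[symmetric]
        atLeastLessThanSuc_atLeastAtMost del: upt_Suc)
qed

lemma carrier_block_diag_gains:
  assumes "K \<in> block_diag_gains N m p"
  shows "K \<in> carrier_mat (\<Sum>i=1..N. m i) (\<Sum>i=1..N. p i)"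
proof -
  from assms obtain Ki where K: "K = diag_block_mat (map Ki [1..<Suc N])"
    and Ki: "\<And>i. i \<in> {1..N} \<Longrightarrow> Ki i \<in> carrier_mat (m i) (p i)"
    by (auto simp: block_diag_gains_def)
  \<comment> \<open>The dimensions of a block-diagonal matrix are list sums of the block dimensions;
    these equations replace them by the prescribed \<open>m i\<close> and
    \<open>p i\<close>.\<close>
  have "map (dim_row \<circ> Ki) [1..<Suc N] = map m [1..<Suc N]"
    "map (dim_col \<circ> Ki) [1..<Suc N] = map p [1..<Suc N]"
    using carrier_matD[OF Ki] by (auto simp del: upt_Suc)
  then show ?thesis
    unfolding K
    by (intro carrier_matI)
      (simp_all add: dim_diag_block_mat sum_set_upt_conv_sum_list_nat[symmetric]
        atLeastLessThanSuc_atLeastAtMost del: upt_Suc)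
qed

text \<open>The off-diagonal blocks are independent of each other, so that one expansion serves both
  the original block matrix and the matrix of the LMI.\<close>

lemma quadratic_form_four_block_mat:
  fixes A B C D :: "'a :: comm_ring mat"
  assumes [simp]: "A \<in> carrier_mat n n" "B \<in> carrier_mat n m"
    "C \<in> carrier_mat m n" "D \<in> carrier_mat m m"
    "x \<in> carrier_vec n" "y \<in> carrier_vec m"
  shows "(x @\<^sub>v y) \<bullet> (four_block_mat A B C D *\<^sub>v (x @\<^sub>v y)) =
    x \<bullet> (A *\<^sub>v x) + x \<bullet> (B *\<^sub>v y) + y \<bullet> (C *\<^sub>v x) + y \<bullet> (D *\<^sub>v y)"
proof -
  note [simp] = mult_mat_vec_carrier[of _ n n] mult_mat_vec_carrier[of _ n m]
    mult_mat_vec_carrier[of _ m n] mult_mat_vec_carrier[of _ m m]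
  have "(x @\<^sub>v y) \<bullet> (four_block_mat A B C D *\<^sub>v (x @\<^sub>v y)) =
      x \<bullet> (A *\<^sub>v x + B *\<^sub>v y) + y \<bullet> (C *\<^sub>v x + D *\<^sub>v y)"
    by (subst four_block_mat_mult_vec[of _ n n _ m _ m], simp_all)
      (rule scalar_prod_append[of _ n _ m], simp_all)
  then show ?thesis
    by (simp add: scalar_prod_add_distrib[of _ n] scalar_prod_add_distrib[of _ m] add.assoc)
qed

lemma nsd_iff:
  assumes "A \<in> carrier_mat k k"
  shows "nsd k A \<longleftrightarrow> A\<^sup>T = A \<and> (\<forall>v \<in> carrier_vec k. v \<bullet> (A *\<^sub>v v) \<le> 0)"
proof -
  have "(- A)\<^sup>T = - A \<longleftrightarrow> A\<^sup>T = A"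
    by (metis transpose_uminus uminus_uminus_mat)
  moreover have "v \<bullet> (- A *\<^sub>v v) = - (v \<bullet> (A *\<^sub>v v))" if "v \<in> carrier_vec k" for v
    using assms that by simp
  ultimately show ?thesis
    using assms by (auto simp: nsd_def psd_mats_def sym_mats_def)
qed

text \<open>Both sides expand to the same terms in \<open>x\<close>, \<open>y\<close> and
  \<open>w = L x\<close>: the off-diagonal LMI blocks supply the two cross terms of the square, and
  \<open>w \<bullet> (R *\<^sub>v w)\<close> cancels on the right. The cross terms are never merged,
  so the identity is purely algebraic.\<close>

lemma lmi_quadratic_form:
  fixes Q S R L :: "'a :: comm_ring mat"
  assumes [simp]: "Q \<in> carrier_mat n n" "S \<in> carrier_mat n m" "R \<in> carrier_mat m m"
    "L \<in> carrier_mat m n" "x \<in> carrier_vec n" "y \<in> carrier_vec m"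
  shows "(x @\<^sub>v y) \<bullet> (four_block_mat (Q + S * L + L\<^sup>T * S\<^sup>T) (L\<^sup>T * R) (R * L) (- R) *\<^sub>v (x @\<^sub>v y)) =
    (x @\<^sub>v (L *\<^sub>v x)) \<bullet> (four_block_mat Q S S\<^sup>T R *\<^sub>v (x @\<^sub>v (L *\<^sub>v x)))
      - (y - L *\<^sub>v x) \<bullet> (R *\<^sub>v (y - L *\<^sub>v x))"
proof -
  define w where "w = L *\<^sub>v x"
  note [simp] = mult_mat_vec_carrier[of _ n n] mult_mat_vec_carrier[of _ n m]
    mult_mat_vec_carrier[of _ m n] mult_mat_vec_carrier[of _ m m]
    mult_carrier_mat[of _ n m] mult_carrier_mat[of _ m m] add_carrier_mat[of _ n n]
  have w [simp]: "w \<in> carrier_vec m"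
    by (simp add: w_def)
  \<comment> \<open>Adjointness moves every leading \<open>L\<^sup>T\<close> onto \<open>x\<close>,
    so that all terms are expressed through \<open>w\<close>.\<close>
  have adj: "x \<bullet> (L\<^sup>T *\<^sub>v u) = w \<bullet> u" if "u \<in> carrier_vec m" for u
    using that transpose_vec_mult_scalar[of L m n x u] comm_scalar_prod[of x n "L\<^sup>T *\<^sub>v u"]
      comm_scalar_prod[of u m w]
    by (simp add: w_def)
  have "x \<bullet> ((Q + S * L + L\<^sup>T * S\<^sup>T) *\<^sub>v x) = x \<bullet> (Q *\<^sub>v x) + x \<bullet> (S *\<^sub>v w) + w \<bullet> (S\<^sup>T *\<^sub>v x)"
    by (simp add: add_mult_distrib_mat_vec[of _ n n] scalar_prod_add_distrib[of _ n]
        assoc_mult_mat_vec[of _ n m _ n] adj w_def[symmetric])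
  moreover have "x \<bullet> ((L\<^sup>T * R) *\<^sub>v y) = w \<bullet> (R *\<^sub>v y)"
    by (simp add: assoc_mult_mat_vec[of _ n m _ m] adj)
  moreover have "y \<bullet> ((R * L) *\<^sub>v x) = y \<bullet> (R *\<^sub>v w)"
    by (simp add: assoc_mult_mat_vec[of _ m m _ n] w_def)
  moreover have "y \<bullet> (- R *\<^sub>v y) = - (y \<bullet> (R *\<^sub>v y))"
    using carrier_matD[OF assms(3)] carrier_vecD[OF assms(6)] by simp
  moreover have "(y - w) \<bullet> (R *\<^sub>v (y - w)) =
      y \<bullet> (R *\<^sub>v y) - y \<bullet> (R *\<^sub>v w) - (w \<bullet> (R *\<^sub>v y) - w \<bullet> (R *\<^sub>v w))"
    by (simp add: mult_minus_distrib_mat_vec[of _ m m] minus_scalar_prod_distrib[of _ m]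
        scalar_prod_minus_distrib[of _ m])
  ultimately show ?thesis
    unfolding w_def[symmetric] by (simp add: quadratic_form_four_block_mat[of _ n _ m])
qed

text \<open>The case of a single index, with \<open>L\<close> standing for \<open>K * C\<close>.
  Symmetry of the LMI matrix is checked first, because \<open>nsd\<close> includes it; completing
  the square then settles the sign.\<close>

lemma quadratic_inequality_iff_lmi:
  fixes Q S R L :: "real mat"
  assumes Q: "Q \<in> carrier_mat n n" and S: "S \<in> carrier_mat n m"
    and L: "L \<in> carrier_mat m n" and sym: "Q\<^sup>T = Q" and psd: "R \<in> psd_mats m"
  shows "(\<forall>x\<in>carrier_vec n.
      (x @\<^sub>v (L *\<^sub>v x)) \<bullet> (four_block_mat Q S S\<^sup>T R *\<^sub>v (x @\<^sub>v (L *\<^sub>v x))) \<le> 0) \<longleftrightarrow>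
    nsd (n + m) (four_block_mat (Q + S * L + L\<^sup>T * S\<^sup>T) (L\<^sup>T * R) (R * L) (- R))"
    (is "(\<forall>x\<in>carrier_vec n. ?q x \<le> 0) \<longleftrightarrow> nsd (n + m) ?F")
proof -
  have R: "R \<in> carrier_mat m m" and Rsym: "R\<^sup>T = R"
    and Rpos: "\<And>v. v \<in> carrier_vec m \<Longrightarrow> 0 \<le> v \<bullet> (R *\<^sub>v v)"
    using psd by (auto simp: psd_mats_def sym_mats_def)
  have SL: "S * L \<in> carrier_mat n n" "L\<^sup>T * S\<^sup>T \<in> carrier_mat n n"
    using S L by auto
  have F: "?F \<in> carrier_mat (n + m) (n + m)"
    using Q SL R by auto
  \<comment> \<open>Transposition fixes \<open>Q\<close> and swaps the other two summands;
    commutativity of addition then restores the order.\<close>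
  have "(Q + S * L + L\<^sup>T * S\<^sup>T)\<^sup>T = Q + L\<^sup>T * S\<^sup>T + S * L"
    using Q SL sym transpose_mult[OF S L] transpose_mult[of "L\<^sup>T" n m "S\<^sup>T" n] S L
    by (simp add: transpose_add[of _ n n])
  also have "\<dots> = Q + S * L + L\<^sup>T * S\<^sup>T"
    using assoc_add_mat[OF Q SL] assoc_add_mat[OF Q SL(2,1)] comm_add_mat[OF SL] by simp
  finally have "?F\<^sup>T = ?F"
    using Q SL R L Rsym transpose_mult[OF R L] transpose_mult[of "L\<^sup>T" n m R m]
    by (subst transpose_four_block_mat[of _ n n _ m _ m]) (auto simp: transpose_uminus)
  \<comment> \<open>Every vector of dimension \<open>n + m\<close> splits as
    \<open>x @\<^sub>v y\<close>, which makes \<open>y\<close> a free variable independent of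
    \<open>x\<close>.\<close>
  then have "nsd (n + m) ?F \<longleftrightarrow>
      (\<forall>x\<in>carrier_vec n. \<forall>y\<in>carrier_vec m. (x @\<^sub>v y) \<bullet> (?F *\<^sub>v (x @\<^sub>v y)) \<le> 0)"
    by (simp add: nsd_iff[OF F] all_vec_append)
  also have "\<dots> \<longleftrightarrow> (\<forall>x\<in>carrier_vec n. \<forall>y\<in>carrier_vec m.
      ?q x - (y - L *\<^sub>v x) \<bullet> (R *\<^sub>v (y - L *\<^sub>v x)) \<le> 0)"
    by (intro ball_cong refl) (simp add: lmi_quadratic_form[OF Q S R L])
  also have "\<dots> \<longleftrightarrow> (\<forall>x\<in>carrier_vec n. ?q x \<le> 0)"
  proof (intro ball_cong refl iffI ballI)
    fix x :: "real vec"
    assume x: "x \<in> carrier_vec n"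
    then have w: "L *\<^sub>v x \<in> carrier_vec m"
      using L by auto
    \<comment> \<open>The instance \<open>y = L x\<close> makes the subtracted square
      vanish.\<close>
    show "?q x \<le> 0" if "\<forall>y\<in>carrier_vec m. ?q x - (y - L *\<^sub>v x) \<bullet> (R *\<^sub>v (y - L *\<^sub>v x)) \<le> 0"
      using bspec[OF that w] w R by simp
    \<comment> \<open>Positive semidefiniteness of \<open>R\<close> enters here: the subtracted
      square is nonnegative.\<close>
    show "?q x - (y - L *\<^sub>v x) \<bullet> (R *\<^sub>v (y - L *\<^sub>v x)) \<le> 0"
      if "?q x \<le> 0" "y \<in> carrier_vec m" for y
      using that Rpos[of "y - L *\<^sub>v x"] w by simp
  qed
  finally show ?thesis ..
qed

theorem theorem5:
  fixes n N M :: nat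
    and m p :: "nat \<Rightarrow> nat"
    and Ci Q S R :: "nat \<Rightarrow> real mat"
    and C K :: "real mat"
  defines "C \<equiv> stack_rows n N Ci"
    and "mtot \<equiv> (\<Sum>i=1..N. m i)"
  assumes "\<And>i. i \<in> {1..N} \<Longrightarrow> 0 < m i"
    and "\<And>i. i \<in> {1..N} \<Longrightarrow> 0 < p i"
    and "\<And>i. i \<in> {1..N} \<Longrightarrow> Ci i \<in> carrier_mat (p i) n"
    and "\<And>j. j \<le> M \<Longrightarrow> Q j \<in> carrier_mat n n"
    and "\<And>j. j \<le> M \<Longrightarrow> S j \<in> carrier_mat n mtot"
    and "\<And>j. j \<le> M \<Longrightarrow> R j \<in> carrier_mat mtot mtot"
    and "\<And>j. j \<le> M \<Longrightarrow> four_block_mat (Q j) (S j) (S j)\<^sup>T (R j) \<in> sym_mats (mtot + n)"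
    and "\<And>j. j \<le> M \<Longrightarrow> R j \<in> psd_mats mtot"
    and "K \<in> block_diag_gains N m p"
  shows
    "(\<forall>j\<le>M. \<forall>x\<in>carrier_vec n.
        (x @\<^sub>v ((K * C) *\<^sub>v x)) \<bullet>
          (four_block_mat (Q j) (S j) (S j)\<^sup>T (R j) *\<^sub>v (x @\<^sub>v ((K * C) *\<^sub>v x))) \<le> 0)
     \<longleftrightarrow>
     (\<forall>j\<le>M. nsd (n + mtot)
        (four_block_mat (Q j + S j * K * C + C\<^sup>T * K\<^sup>T * (S j)\<^sup>T) (C\<^sup>T * K\<^sup>T * R j)
                        (R j * K * C)                               (- R j)))"
proof -
  let ?p = "\<Sum>i=1..N. p i"
  have C: "C \<in> carrier_mat ?p n"
    unfolding C_def using assms(5) by (rule carrier_stack_rows)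
  have K: "K \<in> carrier_mat mtot ?p"
    unfolding mtot_def using assms(11) by (rule carrier_block_diag_gains)
  \<comment> \<open>The equivalence holds for each \<open>j\<close> separately, which is stronger
    than the equivalence of the two families.\<close>
  have "(\<forall>x\<in>carrier_vec n.
        (x @\<^sub>v ((K * C) *\<^sub>v x)) \<bullet>
          (four_block_mat (Q j) (S j) (S j)\<^sup>T (R j) *\<^sub>v (x @\<^sub>v ((K * C) *\<^sub>v x))) \<le> 0) \<longleftrightarrow>
      nsd (n + mtot)
        (four_block_mat (Q j + S j * K * C + C\<^sup>T * K\<^sup>T * (S j)\<^sup>T) (C\<^sup>T * K\<^sup>T * R j)
                        (R j * K * C)                               (- R j))"
    if j: "j \<le> M" for j
  proof -
    note Q = assms(6)[OF j] and S = assms(7)[OF j] and R = assms(8)[OF j]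
    have St: "(S j)\<^sup>T \<in> carrier_mat mtot n"
      using S by simp
    \<comment> \<open>Symmetry is assumed for the whole block matrix; that of \<open>Q j\<close> is
      recovered by comparing entries with both indices below \<open>n\<close>, which lie in the
      upper left block.\<close>
    have "four_block_mat (Q j)\<^sup>T (S j) (S j)\<^sup>T (R j)\<^sup>T = four_block_mat (Q j) (S j) (S j)\<^sup>T (R j)"
      using assms(9)[OF j] transpose_four_block_mat[OF Q S St R] by (simp add: sym_mats_def)
    then have "(Q j)\<^sup>T $$ (a, b) = Q j $$ (a, b)" if "a < n" "b < n" for a b
      using arg_cong[of _ _ "\<lambda>A. A $$ (a, b)"] carrier_matD[OF Q] that
      by (metis index_mat_four_block(1) index_transpose_mat(2,3) trans_less_add1)
    then have "(Q j)\<^sup>T = Q j"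
      using Q by (intro eq_matI) auto
    from quadratic_inequality_iff_lmi[OF Q S mult_carrier_mat[OF K C] this assms(10)[OF j]]
    show ?thesis
      \<comment> \<open>Regroups the left-associated products so that \<open>K * C\<close> appears
        as the single factor \<open>L\<close>, with \<open>(K * C)\<^sup>T\<close> split into
        \<open>C\<^sup>T * K\<^sup>T\<close>.\<close>
      by (simp only: transpose_mult[OF K C] assoc_mult_mat[OF S K C] assoc_mult_mat[OF R K C])
  qed
  then show ?thesis
    by blast
qed

end
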